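(* Let $\Pi_n$ be a uniformly random permutation of $[n]$ and let $\alpha_n$ be the maximum length of alternating twins in $\Pi_n$. Then for every $\varepsilon>0$, with probability tending to $1$ as $n\to\infty$, \[\alpha_n\ge\left(\tfrac13+0.0989-\varepsilon\right)n.\]
   Context: A subsequence $\pi_{i_1},\pi_{i_2},\dots,\pi_{i_\ell}$ ($i_1<\cdots<i_\ell$) of a permutation $\pi$ is alternating if $\pi_{i_1}>\pi_{i_2}<\pi_{i_3}>\cdots$ (up-and-down alternation). Alternating twins of length $\ell$ in $\pi$ are two disjoint (in positions) alternating subsequences of $\pi$, each of length $\ell$. $\alpha_n$ denotes the largest $\ell$ such that $\Pi_n$ contains alternating twins of length $\ell$. *)

theory Defs
  imports "HOL-Probability.Probability" "HOL-Combinatorics.Permutations"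
begin

text \<open>
  A permutation of \<open>[n]\<close> is a function \<open>\<pi>\<close> with \<open>\<pi> permutes {1..n}\<close>, so that its \<open>i\<close>-th
  entry is \<open>\<pi> i\<close>. A subsequence is represented by the increasing list of its positions.
  List indices start at 0, so a step at an even list index is a descent and the alternation
  always begins with a descent.
\<close>

definition alternating_subseq :: "nat \<Rightarrow> (nat \<Rightarrow> nat) \<Rightarrow> nat list \<Rightarrow> bool" where
  "alternating_subseq n \<pi> is \<longleftrightarrow>
     set is \<subseteq> {1..n} \<and> sorted_wrt (<) is \<and>
     (\<forall>j. Suc j < length is \<longrightarrow>
        (if even j then \<pi> (is ! j) > \<pi> (is ! Suc j) else \<pi> (is ! j) < \<pi> (is ! Suc j)))"

definition has_alternating_twins :: "nat \<Rightarrow> (nat \<Rightarrow> nat) \<Rightarrow> nat \<Rightarrow> bool" where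
  "has_alternating_twins n \<pi> l \<longleftrightarrow>
     (\<exists>is js. alternating_subseq n \<pi> is \<and> alternating_subseq n \<pi> js \<and>
        length is = l \<and> length js = l \<and> set is \<inter> set js = {})"

definition max_alternating_twins :: "nat \<Rightarrow> (nat \<Rightarrow> nat) \<Rightarrow> nat" where
  "max_alternating_twins n \<pi> = Max {l. has_alternating_twins n \<pi> l}"

text \<open>The maximum is taken over a finite nonempty set, hence is meaningful.\<close>

lemma has_alternating_twins_0: "has_alternating_twins n \<pi> 0"
  by (auto simp: has_alternating_twins_def alternating_subseq_def)

lemma has_alternating_twins_le:
  assumes "has_alternating_twins n \<pi> l"
  shows "l \<le> n"
proof -
  from assms obtain xs where xs: "set xs \<subseteq> {1..n}" "sorted_wrt (<) xs" "length xs = l"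
    by (auto simp: has_alternating_twins_def alternating_subseq_def)
  then have "card (set xs) = l"
    by (simp add: strict_sorted_iff distinct_card)
  moreover have "card (set xs) \<le> card {1..n}"
    using xs(1) by (intro card_mono) auto
  ultimately show ?thesis by simp
qed

lemma finite_has_alternating_twins: "finite {l. has_alternating_twins n \<pi> l}"
  by (rule finite_subset[of _ "{..n}"]) (auto dest: has_alternating_twins_le)

definition random_permutation :: "nat \<Rightarrow> (nat \<Rightarrow> nat) pmf" where
  "random_permutation n = pmf_of_set {\<pi>. \<pi> permutes {1..n}}"

end

theory Submission
  imports Defs "HOL-Real_Asymp.Real_Asymp"
begin

text \<open>
  Replace the values of the permutation by ten levels of equal size and read the resulting word
  from left to right while growing two disjoint alternating subsequences. Only the direction
  that each of them needs next and the level of its last entry matter. A last entry that a new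
  letter improves upon is exchanged for it. When both subsequences could take a letter, the
  decision is postponed by one step. A potential function on the finitely many states shows
  that for independent uniform letters the total length grows by at least
  \<open>433 / 500 = 0.866 > 2 (1 / 3 + 0.0989)\<close> per letter on average.

  In a random permutation the levels at boundedly many positions are asymptotically independent
  and uniform. So the position set is cut into blocks of constant length, a second moment
  argument yields concentration of the sum of the block totals, and the pairs found in the blocks
  are concatenated at a bounded cost per block, giving the longer piece of each block to the
  currently shorter twin.
\<close>

section \<open>Alternating sequences and disjoint subsequences\<close>

fun alt :: "bool \<Rightarrow> 'a::linorder list \<Rightarrow> bool" where
  "alt desc (x # y # xs) \<longleftrightarrow> (if desc then y < x else x < y) \<and> alt (\<not> desc) (y # xs)"
| "alt desc xs \<longleftrightarrow> True"

text \<open>The junction is the step just before the first step of \<open>ys\<close>, so its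
  direction is opposite to the one with which \<open>ys\<close> has to start.\<close>

lemma alt_append:
  "alt desc (xs @ ys) \<longleftrightarrow> alt desc xs \<and> alt (desc = even (length xs)) ys \<and>
     (xs \<noteq> [] \<and> ys \<noteq> [] \<longrightarrow>
       (if desc = even (length xs) then last xs < hd ys else hd ys < last xs))"
proof (induction desc xs rule: alt.induct)
  case (1 desc x y xs)
  then show ?case by auto
next
  case ("2_2" desc x)
  then show ?case by (cases ys) auto
qed auto

lemma alt_snoc:
  "alt desc (xs @ [x]) \<longleftrightarrow> alt desc xs \<and>
     (xs \<noteq> [] \<longrightarrow> (if desc = even (length xs) then last xs < x else x < last xs))"
  by (simp add: alt_append)

lemma alt_take: "alt desc xs \<Longrightarrow> alt desc (take k xs)"
  using alt_append[of desc "take k xs" "drop k xs"] by simp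

lemma alt_iff_nth:
  "alt desc xs \<longleftrightarrow> (\<forall>j. Suc j < length xs \<longrightarrow>
     (if even j = desc then xs ! j > xs ! Suc j else xs ! j < xs ! Suc j))"
proof (induction desc xs rule: alt.induct)
  case (1 desc x y xs)
  have split: "(\<forall>j. P j) \<longleftrightarrow> P 0 \<and> (\<forall>j. P (Suc j))" for P :: "nat \<Rightarrow> bool"
    by (metis nat.exhaust)
  show ?case
    unfolding alt.simps 1 by (subst (2) split) auto
qed auto

lemma alternating_subseq_iff_alt:
  "alternating_subseq n \<pi> is \<longleftrightarrow> set is \<subseteq> {1..n} \<and> sorted_wrt (<) is \<and> alt True (map \<pi> is)"
  by (auto simp: alternating_subseq_def alt_iff_nth)

text \<open>A strict inequality between images under a monotone map forces the same one between the
  arguments. Alternation in the word of levels is therefore alternation in the permutation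
  itself.\<close>

lemma alt_map_reflect:
  fixes g :: "'b::linorder \<Rightarrow> 'c::linorder"
  assumes "mono g" "alt desc (map g xs)"
  shows "alt desc xs"
  using assms(2) monoD[OF assms(1)]
  by (induction desc xs rule: alt.induct) (auto split: if_splits simp: not_le[symmetric])

text \<open>Disjointness refers to occurrences, so letters may repeat. The rules append on the
  right, in the order in which a word is read.\<close>

inductive disjoint_subseqs :: "'a list \<Rightarrow> 'a list \<Rightarrow> 'a list \<Rightarrow> bool" where
  empty: "disjoint_subseqs [] [] []"
| skip: "disjoint_subseqs w a b \<Longrightarrow> disjoint_subseqs (w @ [x]) a b"
| left: "disjoint_subseqs w a b \<Longrightarrow> disjoint_subseqs (w @ [x]) (a @ [x]) b"
| right: "disjoint_subseqs w a b \<Longrightarrow> disjoint_subseqs (w @ [x]) a (b @ [x])"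

lemma disjoint_subseqs_sym: "disjoint_subseqs w a b \<Longrightarrow> disjoint_subseqs w b a"
  by (induction rule: disjoint_subseqs.induct) (auto intro: disjoint_subseqs.intros)

lemma disjoint_subseqs_butlast: "disjoint_subseqs w a b \<Longrightarrow> disjoint_subseqs w (butlast a) b"
  by (induction rule: disjoint_subseqs.induct) (auto intro: disjoint_subseqs.intros)

lemma disjoint_subseqs_length: "disjoint_subseqs w a b \<Longrightarrow> length a + length b \<le> length w"
  by (induction rule: disjoint_subseqs.induct) auto

lemma disjoint_subseqs_Nil: "disjoint_subseqs w [] []"
  by (induction w rule: rev_induct) (auto intro: disjoint_subseqs.intros)

text \<open>Recovers positions: with \<open>w\<close> a list of positions and \<open>g\<close>
  giving the letter at a position, a pair in the word comes from a pair of position lists.\<close>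

lemma disjoint_subseqs_map:
  assumes "disjoint_subseqs (map g w) a b"
  obtains A B where "disjoint_subseqs w A B" "a = map g A" "b = map g B"
proof -
  have "\<exists>A B. disjoint_subseqs w A B \<and> a = map g A \<and> b = map g B" if "disjoint_subseqs v a b" "v = map g w" for v
    using that
  proof (induction arbitrary: w rule: disjoint_subseqs.induct)
    case empty
    then show ?case by (auto intro: disjoint_subseqs.intros)
  next
    case (skip v a b x)
    then obtain w' y where "w = w' @ [y]" "v = map g w'" "x = g y"
      by (auto simp: append_eq_map_conv Cons_eq_map_conv)
    then show ?case using skip.IH[of w'] by (blast intro: disjoint_subseqs.skip)
  next
    case (left v a b x)
    then obtain w' y where w: "w = w' @ [y]" "v = map g w'" "x = g y"
      by (auto simp: append_eq_map_conv Cons_eq_map_conv)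
    then obtain A B where "disjoint_subseqs w' A B" "a = map g A" "b = map g B"
      using left.IH[of w'] by blast
    then show ?case using w by (intro exI[of _ "A @ [y]"] exI[of _ B]) (auto intro: disjoint_subseqs.left)
  next
    case (right v a b x)
    then obtain w' y where w: "w = w' @ [y]" "v = map g w'" "x = g y"
      by (auto simp: append_eq_map_conv Cons_eq_map_conv)
    then obtain A B where "disjoint_subseqs w' A B" "a = map g A" "b = map g B"
      using right.IH[of w'] by blast
    then show ?case using w by (intro exI[of _ A] exI[of _ "B @ [y]"]) (auto intro: disjoint_subseqs.right)
  qed
  then show ?thesis using assms that by blast
qed

lemma disjoint_subseqs_set: "disjoint_subseqs w a b \<Longrightarrow> set a \<union> set b \<subseteq> set w"
  by (induction rule: disjoint_subseqs.induct) auto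

lemma disjoint_subseqs_sorted:
  "disjoint_subseqs w a b \<Longrightarrow> sorted_wrt (<) (w :: 'a::linorder list) \<Longrightarrow>
     sorted_wrt (<) a \<and> sorted_wrt (<) b \<and> set a \<inter> set b = {}"
proof (induction rule: disjoint_subseqs.induct)
  case (skip w a b x)
  then show ?case by (auto simp: sorted_wrt_append)
next
  case (left w a b x)
  then show ?case using disjoint_subseqs_set[OF left.hyps] by (fastforce simp: sorted_wrt_append)
next
  case (right w a b x)
  then show ?case using disjoint_subseqs_set[OF right.hyps] by (fastforce simp: sorted_wrt_append)
qed auto

section \<open>States and potential\<close>

text \<open>
  \<open>Low b c\<close>: both subsequences need a larger letter next, their last letters being at most \<open>b\<close>
  and \<open>c\<close>; an empty subsequence counts as such. \<open>High b c\<close>: both need a smaller letter, their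
  last letters being at least \<open>b\<close> and \<open>c\<close>. \<open>Mixed d u\<close>: one needs a smaller letter after a last
  letter at least \<open>d\<close>, the other a larger one after a last letter at most \<open>u\<close>.
  \<open>Pending d u y\<close>: in state \<open>Mixed d u\<close> the letter \<open>y\<close> was taken, but which subsequence
  receives it is still open, so that both \<open>Low u y\<close> and \<open>High d y\<close> are available.
\<close>

datatype state = Mixed nat nat | Low nat nat | High nat nat | Pending nat nat nat

text \<open>Each move is a gain in total length with the next state. The minimum covers both
  skipping \<open>x\<close> and exchanging a last letter for a smaller \<open>x\<close>.\<close>

definition low_moves :: "nat \<Rightarrow> nat \<Rightarrow> nat \<Rightarrow> (nat \<times> state) list" where
  "low_moves b c x = [(0, Low (min b x) c), (0, Low b (min c x))]
     @ (if b < x then [(1, Mixed x c)] else []) @ (if c < x then [(1, Mixed x b)] else [])"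

definition high_moves :: "nat \<Rightarrow> nat \<Rightarrow> nat \<Rightarrow> (nat \<times> state) list" where
  "high_moves b c x = [(0, High (max b x) c), (0, High b (max c x))]
     @ (if x < b then [(1, Mixed c x)] else []) @ (if x < c then [(1, Mixed b x)] else [])"

text \<open>The letter \<open>y\<close> of a pending state was counted on entering it. The next move
  settles its owner, acting as a move from \<open>Low u y\<close> or from
  \<open>High d y\<close>.\<close>

fun moves :: "state \<Rightarrow> nat \<Rightarrow> (nat \<times> state) list" where
  "moves (Low b c) x = low_moves b c x"
| "moves (High b c) x = high_moves b c x"
| "moves (Mixed d u) x = [(0, Mixed (max d x) u), (0, Mixed d (min u x))]
     @ (if x < d then [(1, Low u x)] else []) @ (if u < x then [(1, High d x)] else [])
     @ (if u < x \<and> x < d then [(1, Pending d u x)] else [])"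
| "moves (Pending d u y) x = low_moves u y x @ high_moves d y x"

fun wf_state :: "state \<Rightarrow> bool" where
  "wf_state (Low b c) \<longleftrightarrow> b < 10 \<and> c < 10"
| "wf_state (High b c) \<longleftrightarrow> b < 10 \<and> c < 10"
| "wf_state (Mixed d u) \<longleftrightarrow> d < 10 \<and> u < 10"
| "wf_state (Pending d u y) \<longleftrightarrow> d < 10 \<and> u < 10 \<and> y < 10"

text \<open>
  The tables are rounded negated relative values, in units of \<open>1 / 50\<close> letter, of the Markov
  decision process given by the moves, as computed by value iteration; the gain of
  \<open>433 / 500\<close> per letter is \<open>433\<close> when summed over the ten letters in these units.
  Reversing the order of the levels exchanges \<open>Low\<close> and \<open>High\<close>, so one table serves both.
\<close>

definition mixed_table :: "int list list" where
  "mixed_table =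
   [[66, 67, 68, 70, 73, 75, 80, 87, 99, 113],
    [52, 52, 53, 54, 56, 59, 65, 74, 86, 99],
    [36, 37, 38, 39, 42, 46, 52, 62, 74, 87],
    [25, 26, 27, 29, 32, 36, 43, 52, 65, 80],
    [17, 18, 20, 22, 25, 29, 36, 46, 59, 75],
    [11, 12, 14, 17, 21, 25, 32, 42, 56, 73],
    [7, 8, 10, 13, 17, 22, 29, 39, 54, 70],
    [4, 5, 7, 10, 14, 20, 27, 38, 53, 68],
    [1, 2, 5, 8, 12, 18, 26, 37, 52, 67],
    [0, 1, 4, 7, 11, 17, 25, 36, 52, 66]]"

definition low_table :: "int list list" where
  "low_table =
   [[16, 16, 16, 17, 18, 21, 27, 35, 48, 61],
    [16, 18, 18, 19, 20, 23, 27, 35, 48, 62],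
    [16, 18, 23, 23, 24, 26, 30, 37, 49, 64],
    [17, 19, 23, 30, 31, 32, 35, 41, 51, 65],
    [18, 20, 24, 31, 40, 40, 42, 46, 55, 66],
    [21, 23, 26, 32, 40, 51, 52, 54, 61, 70],
    [27, 27, 30, 35, 42, 52, 64, 65, 70, 77],
    [35, 35, 37, 41, 46, 54, 65, 81, 82, 87],
    [48, 48, 49, 51, 55, 61, 70, 82, 100, 102],
    [61, 62, 64, 65, 66, 70, 77, 87, 102, 121]]"

text \<open>Pending states get the placeholder 0: their moves lead only to the other kinds of state,
  so \<open>potential\<close> can compute their actual value from this function.\<close>

fun base_potential :: "state \<Rightarrow> int" where
  "base_potential (Low b c) = - (low_table ! b ! c)"
| "base_potential (High b c) = - (low_table ! (9 - b) ! (9 - c))"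
| "base_potential (Mixed d u) = - (mixed_table ! d ! u)"
| "base_potential (Pending d u y) = 0"

text \<open>The value of an optimal move in the decision process, a taken letter being worth 50
  units.\<close>

definition best_of :: "(state \<Rightarrow> int) \<Rightarrow> (nat \<times> state) list \<Rightarrow> int" where
  "best_of h ms = Max ((\<lambda>(k, s). 50 * int k + h s) ` set ms)"

definition letters :: "nat list" where "letters = [0, 1, 2, 3, 4, 5, 6, 7, 8, 9]"

text \<open>The potential of a pending state is the largest one compatible with the required gain.\<close>

fun potential :: "state \<Rightarrow> int" where
  "potential (Pending d u y) =
     (sum_list (map (\<lambda>x. best_of base_potential (moves (Pending d u y) x)) letters) - 433) div 10"
| "potential s = base_potential s"

text \<open>The Bellman inequality for a gain of \<open>433 / 10\<close> units per letter,
  multiplied by 10 to stay within the integers.\<close>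

definition gains :: "state \<Rightarrow> bool" where
  "gains s \<longleftrightarrow> 10 * potential s + 433 \<le> sum_list (map (\<lambda>x. best_of potential (moves s x)) letters)"

text \<open>Here and in the next two lemmas all 100 states of one kind are checked by evaluation.
  Pending states satisfy the inequality by the choice of their potential.\<close>

lemma gains_Low: "list_all (\<lambda>b. list_all (\<lambda>c. gains (Low b c)) letters) letters"
  by code_simp
lemma gains_High: "list_all (\<lambda>b. list_all (\<lambda>c. gains (High b c)) letters) letters"
  by code_simp
lemma gains_Mixed: "list_all (\<lambda>b. list_all (\<lambda>c. gains (Mixed b c)) letters) letters"
  by code_simp

section \<open>Average length of twins in a random word\<close>

text \<open>An alternation that begins with a descent has to rise next exactly after an even number
  of letters. The empty list qualifies for every \<open>u\<close>.\<close>

definition awaits_rise :: "'a::linorder \<Rightarrow> 'a list \<Rightarrow> bool" where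
  "awaits_rise u a \<longleftrightarrow> even (length a) \<and> alt True a \<and> (a \<noteq> [] \<longrightarrow> last a \<le> u)"

definition awaits_drop :: "'a::linorder \<Rightarrow> 'a list \<Rightarrow> bool" where
  "awaits_drop d a \<longleftrightarrow> odd (length a) \<and> alt True a \<and> d \<le> last a"

lemma awaits_rise_snoc: "awaits_rise u a \<Longrightarrow> u < x \<Longrightarrow> awaits_drop x (a @ [x])"
  by (auto simp: awaits_rise_def awaits_drop_def alt_snoc)

lemma awaits_drop_snoc: "awaits_drop d a \<Longrightarrow> x < d \<Longrightarrow> awaits_rise x (a @ [x])"
  by (auto simp: awaits_rise_def awaits_drop_def alt_snoc)

text \<open>A nonempty list of even length ends with a descent, so a smaller \<open>x\<close> may
  replace its last letter; otherwise \<open>x\<close> is skipped.\<close>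

lemma awaits_rise_replace:
  assumes "awaits_rise u a" "disjoint_subseqs w a b"
  obtains a' where "awaits_rise (min u x) a'" "disjoint_subseqs (w @ [x]) a' b" "length a' = length a"
proof (cases "a = [] \<or> last a \<le> x")
  case True
  with assms show ?thesis
    by (intro that[of a]) (auto simp: awaits_rise_def intro: disjoint_subseqs.skip)
next
  case False
  then obtain c l where a: "a = c @ [l]" and "x < l" by (cases a rule: rev_cases) auto
  moreover have "disjoint_subseqs w c b"
    using disjoint_subseqs_butlast[OF assms(2)] a by simp
  ultimately show ?thesis using assms(1)
    by (intro that[of "c @ [x]"]) (auto simp: awaits_rise_def alt_snoc intro: disjoint_subseqs.left)
qed

text \<open>The mirror image: the last letter is a peak or the only letter, so a larger
  \<open>x\<close> may replace it.\<close>

lemma awaits_drop_replace: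
  assumes "awaits_drop d a" "disjoint_subseqs w a b"
  obtains a' where "awaits_drop (max d x) a'" "disjoint_subseqs (w @ [x]) a' b" "length a' = length a"
proof (cases "x \<le> last a")
  case True
  with assms show ?thesis
    by (intro that[of a]) (auto simp: awaits_drop_def intro: disjoint_subseqs.skip)
next
  case False
  moreover have "a \<noteq> []" using assms(1) by (auto simp: awaits_drop_def)
  ultimately obtain c l where a: "a = c @ [l]" and "l < x" by (cases a rule: rev_cases) auto
  moreover have "disjoint_subseqs w c b"
    using disjoint_subseqs_butlast[OF assms(2)] a by simp
  ultimately show ?thesis using assms(1)
    by (intro that[of "c @ [x]"]) (auto simp: awaits_drop_def alt_snoc intro: disjoint_subseqs.left)
qed

section \<open>Realising the moves by subsequences\<close>

definition attains :: "'a list \<Rightarrow> ('a list \<Rightarrow> bool) \<Rightarrow> ('a list \<Rightarrow> bool) \<Rightarrow> nat \<Rightarrow> bool" where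
  "attains w P Q r \<longleftrightarrow> (\<exists>p q. disjoint_subseqs w p q \<and> P p \<and> Q q \<and> length p + length q = r)"

text \<open>Here \<open>r\<close> is the total length of the pair. A pending state asserts two pairs
  of the same total length, one for each possible owner of \<open>y\<close>.\<close>

fun reach :: "nat list \<Rightarrow> state \<Rightarrow> nat \<Rightarrow> bool" where
  "reach w (Low b c) r \<longleftrightarrow> attains w (awaits_rise b) (awaits_rise c) r"
| "reach w (High b c) r \<longleftrightarrow> attains w (awaits_drop b) (awaits_drop c) r"
| "reach w (Mixed d u) r \<longleftrightarrow> attains w (awaits_drop d) (awaits_rise u) r"
| "reach w (Pending d u y) r \<longleftrightarrow>
     attains w (awaits_rise u) (awaits_rise y) r \<and> attains w (awaits_drop d) (awaits_drop y) r"

lemma attainsI: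
  "disjoint_subseqs w p q \<Longrightarrow> P p \<Longrightarrow> Q q \<Longrightarrow> length p + length q = r \<Longrightarrow> attains w P Q r"
  unfolding attains_def by blast

lemma attains_sym: "attains w P Q r \<Longrightarrow> attains w Q P r"
  unfolding attains_def by (metis add.commute disjoint_subseqs_sym)

lemma attains_rise_replace:
  assumes "attains w (awaits_rise u) Q r"
  shows "attains (w @ [x]) (awaits_rise (min u x)) Q r"
proof -
  obtain p q where pq: "disjoint_subseqs w p q" "awaits_rise u p" "Q q" "length p + length q = r"
    using assms by (auto simp: attains_def)
  obtain p' where "awaits_rise (min u x) p'" "disjoint_subseqs (w @ [x]) p' q" "length p' = length p"
    using awaits_rise_replace[OF pq(2,1)] .
  with pq(3,4) show ?thesis by (intro attainsI[of _ p' q]) auto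
qed

lemma attains_drop_replace:
  assumes "attains w (awaits_drop d) Q r"
  shows "attains (w @ [x]) (awaits_drop (max d x)) Q r"
proof -
  obtain p q where pq: "disjoint_subseqs w p q" "awaits_drop d p" "Q q" "length p + length q = r"
    using assms by (auto simp: attains_def)
  obtain p' where "awaits_drop (max d x) p'" "disjoint_subseqs (w @ [x]) p' q" "length p' = length p"
    using awaits_drop_replace[OF pq(2,1)] .
  with pq(3,4) show ?thesis by (intro attainsI[of _ p' q]) auto
qed

lemma attains_rise:
  assumes "attains w (awaits_rise u) Q r" "u < x"
  shows "attains (w @ [x]) (awaits_drop x) Q (Suc r)"
proof -
  obtain p q where "disjoint_subseqs w p q" "awaits_rise u p" "Q q" "length p + length q = r"
    using assms(1) by (auto simp: attains_def)
  then show ?thesis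
    using awaits_rise_snoc[OF _ assms(2)]
    by (intro attainsI[of _ "p @ [x]" q]) (auto intro: disjoint_subseqs.left)
qed

lemma attains_drop:
  assumes "attains w (awaits_drop d) Q r" "x < d"
  shows "attains (w @ [x]) (awaits_rise x) Q (Suc r)"
proof -
  obtain p q where "disjoint_subseqs w p q" "awaits_drop d p" "Q q" "length p + length q = r"
    using assms(1) by (auto simp: attains_def)
  then show ?thesis
    using awaits_drop_snoc[OF _ assms(2)]
    by (intro attainsI[of _ "p @ [x]" q]) (auto intro: disjoint_subseqs.left)
qed

lemma reach_low_moves:
  assumes r: "reach w (Low b c) r" and ks: "(k, s) \<in> set (low_moves b c x)"
  shows "reach (w @ [x]) s (r + k)"
proof -
  from r have bc: "attains w (awaits_rise b) (awaits_rise c) r" by simp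
  note cb = attains_sym[OF bc]
  from ks consider "(k, s) = (0, Low (min b x) c)" | "(k, s) = (0, Low b (min c x))"
    | "b < x" "(k, s) = (1, Mixed x c)" | "c < x" "(k, s) = (1, Mixed x b)"
    by (auto simp: low_moves_def split: if_splits)
  then show ?thesis
    using attains_rise_replace[OF bc] attains_sym[OF attains_rise_replace[OF cb]]
      attains_rise[OF bc] attains_rise[OF cb]
    by cases simp_all
qed

lemma reach_high_moves:
  assumes r: "reach w (High b c) r" and ks: "(k, s) \<in> set (high_moves b c x)"
  shows "reach (w @ [x]) s (r + k)"
proof -
  from r have bc: "attains w (awaits_drop b) (awaits_drop c) r" by simp
  note cb = attains_sym[OF bc]
  from ks consider "(k, s) = (0, High (max b x) c)" | "(k, s) = (0, High b (max c x))"
    | "x < b" "(k, s) = (1, Mixed c x)" | "x < c" "(k, s) = (1, Mixed b x)"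
    by (auto simp: high_moves_def split: if_splits)
  then show ?thesis
    using attains_drop_replace[OF bc] attains_sym[OF attains_drop_replace[OF cb]]
      attains_sym[OF attains_drop[OF bc]] attains_sym[OF attains_drop[OF cb]]
    by cases simp_all
qed

text \<open>Every move is realised with exactly its gain. The pending move is offered only when both
  subsequences can take \<open>x\<close>, so both of its alternatives are realised.\<close>

lemma reach_moves:
  assumes "reach w s r" "(k, s') \<in> set (moves s x)"
  shows "reach (w @ [x]) s' (r + k)"
proof (cases s)
  case (Mixed d u)
  with assms(1) have du: "attains w (awaits_drop d) (awaits_rise u) r" by simp
  note ud = attains_sym[OF du]
  have low: "reach (w @ [x]) (Low u x) (Suc r)" if "x < d"
    using attains_sym[OF attains_drop[OF du that]] by simp
  have high: "reach (w @ [x]) (High d x) (Suc r)" if "u < x"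
    using attains_sym[OF attains_rise[OF ud that]] by simp
  from assms(2) Mixed consider "(k, s') = (0, Mixed (max d x) u)" | "(k, s') = (0, Mixed d (min u x))"
    | "x < d" "(k, s') = (1, Low u x)" | "u < x" "(k, s') = (1, High d x)"
    | "u < x" "x < d" "(k, s') = (1, Pending d u x)"
    by (auto split: if_splits)
  then show ?thesis
    using attains_drop_replace[OF du] attains_sym[OF attains_rise_replace[OF ud]] low high
    by cases simp_all
next
  case (Pending d u y)
  with assms(1) have "reach w (Low u y) r" "reach w (High d y) r" by simp_all
  moreover have "(k, s') \<in> set (low_moves u y x) \<or> (k, s') \<in> set (high_moves d y x)"
    using assms(2) Pending by simp
  ultimately show ?thesis using reach_low_moves reach_high_moves by blast
next
  case (Low b c)
  then show ?thesis using assms reach_low_moves by simp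
next
  case (High b c)
  then show ?thesis using assms reach_high_moves by simp
qed

lemma wf_moves: "wf_state s \<Longrightarrow> x < 10 \<Longrightarrow> (k, s') \<in> set (moves s x) \<Longrightarrow> wf_state s'"
  by (cases s) (auto simp: low_moves_def high_moves_def split: if_splits)

lemma moves_nonempty: "moves s x \<noteq> []"
  by (cases s) (auto simp: low_moves_def high_moves_def)

lemma best_of_attained:
  assumes "ms \<noteq> []"
  obtains k s where "(k, s) \<in> set ms" "best_of h ms = 50 * int k + h s"
proof -
  have "best_of h ms \<in> (\<lambda>(k, s). 50 * int k + h s) ` set ms"
    unfolding best_of_def using assms by (intro Max_in) auto
  then show ?thesis using that by auto
qed

lemma sum_list_letters: "sum_list (map f letters) = (\<Sum>x<10. f x)" for f :: "nat \<Rightarrow> int"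
  by (simp add: letters_def numeral_eq_Suc)

lemma set_letters: "set letters = {..<10}"
  by (auto simp: letters_def)

text \<open>For a pending state the inequality comes from rounding down in its potential, because
  both potentials agree on its successors. The other kinds were checked by evaluation.\<close>

lemma potential_gain:
  assumes "wf_state s"
  shows "10 * potential s + 433 \<le> (\<Sum>x<10. best_of potential (moves s x))"
proof (cases s)
  case (Pending d u y)
  have "best_of potential (moves s x) = best_of base_potential (moves s x)" for x
    unfolding best_of_def Pending
    by (intro arg_cong[of _ _ Max] image_cong) (auto simp: low_moves_def high_moves_def split: if_splits)
  then show ?thesis
    by (simp add: Pending sum_list_letters)
qed (use assms gains_Low gains_High gains_Mixed in
    \<open>simp_all add: list_all_iff set_letters gains_def sum_list_letters del: moves.simps potential.simps\<close>)

lemma base_potential_nonpos: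
  assumes "wf_state s" shows "base_potential s \<le> 0"
proof -
  have len: "length low_table = 10" "length mixed_table = 10"
    "\<forall>row \<in> set low_table. length row = 10 \<and> (\<forall>v \<in> set row. 0 \<le> v)"
    "\<forall>row \<in> set mixed_table. length row = 10 \<and> (\<forall>v \<in> set row. 0 \<le> v)"
    by (simp_all add: low_table_def mixed_table_def)
  have entry: "0 \<le> low_table ! i ! j" "0 \<le> mixed_table ! i ! j" if "i < 10" "j < 10" for i j
    using that len by (metis nth_mem)+
  show ?thesis using assms by (cases s) (auto intro: entry)
qed

lemma moves_reward_le: "(k, s') \<in> set (moves s x) \<Longrightarrow> k \<le> 1"
  by (cases s) (auto simp: low_moves_def high_moves_def split: if_splits)

text \<open>Bounds the potential left over at the end of a word by the worth of one letter.\<close>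

lemma potential_le:
  assumes "wf_state s" shows "potential s \<le> 50"
proof (cases s)
  case (Pending d u y)
  have "best_of base_potential (moves s x) \<le> 50" if "x < 10" for x
  proof -
    obtain k s' where ks: "(k, s') \<in> set (moves s x)"
      "best_of base_potential (moves s x) = 50 * int k + base_potential s'"
      using best_of_attained[OF moves_nonempty] .
    then show ?thesis
      using base_potential_nonpos[OF wf_moves[OF assms that ks(1)]] moves_reward_le[OF ks(1)] by simp
  qed
  then have "(\<Sum>x<10. best_of base_potential (moves s x)) \<le> (\<Sum>x<(10::nat). 50)"
    by (intro sum_mono) auto
  then show ?thesis by (simp add: Pending sum_list_letters)
qed (use base_potential_nonpos[OF assms] in auto)

text \<open>The two lengths may differ; they are balanced only when blocks are concatenated.\<close>

definition twin_total :: "'a::linorder list \<Rightarrow> nat" where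
  "twin_total w = Max {length p + length q |p q. disjoint_subseqs w p q \<and> alt True p \<and> alt True q}"

lemma twin_total_attained:
  obtains p q where "disjoint_subseqs w p q" "alt True p" "alt True q" "twin_total w = length p + length q"
proof -
  let ?A = "{length p + length q |p q. disjoint_subseqs w p q \<and> alt True p \<and> alt True q}"
  have "finite ?A"
    by (rule finite_subset[of _ "{..length w}"]) (auto dest: disjoint_subseqs_length)
  moreover have "0 \<in> ?A" using disjoint_subseqs_Nil[of w] by (auto intro!: exI[of _ "[]"])
  then have "?A \<noteq> {}" by blast
  ultimately have "twin_total w \<in> ?A" unfolding twin_total_def by (rule Max_in)
  then show ?thesis using that by auto
qed

lemma twin_total_ge:
  assumes "disjoint_subseqs w p q" "alt True p" "alt True q"
  shows "length p + length q \<le> twin_total w"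
proof -
  let ?A = "{length p + length q |p q. disjoint_subseqs w p q \<and> alt True p \<and> alt True q}"
  have "finite ?A"
    by (rule finite_subset[of _ "{..length w}"]) (auto dest: disjoint_subseqs_length)
  then show ?thesis unfolding twin_total_def using assms by (intro Max_ge) auto
qed

lemma twin_total_le: "twin_total w \<le> length w"
  using twin_total_attained[of w] disjoint_subseqs_length by metis

lemma reach_le_twin_total: "reach w s r \<Longrightarrow> r \<le> twin_total w"
  by (cases s) (auto simp: attains_def awaits_rise_def awaits_drop_def intro: twin_total_ge)

section \<open>Averages over all words of a given length\<close>

definition words :: "nat \<Rightarrow> nat list set" where
  "words k = {w. set w \<subseteq> {..<10} \<and> length w = k}"

lemma finite_words: "finite (words k)"
  unfolding words_def by (rule finite_lists_length_eq) simp

lemma card_words: "card (words k) = 10 ^ k"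
  unfolding words_def by (simp add: card_lists_length_eq)

lemma words_0: "words 0 = {[]}"
  by (auto simp: words_def)

lemma sum_words_Suc: "(\<Sum>w\<in>words (Suc k). f w) = (\<Sum>x<10. \<Sum>w\<in>words k. f (x # w))"
proof -
  have "(\<Sum>x<10. \<Sum>w\<in>words k. f (x # w)) = (\<Sum>(x, w)\<in>{..<10} \<times> words k. f (x # w))"
    by (rule sum.cartesian_product)
  also have "\<dots> = (\<Sum>w\<in>words (Suc k). f w)"
    by (rule sum.reindex_bij_witness[of _ "\<lambda>w. (hd w, tl w)" "\<lambda>(x, w). x # w"])
      (auto simp: words_def length_Suc_conv)
  finally show ?thesis ..
qed

text \<open>Dynamic programming on the number \<open>k\<close> of letters still to be read after the
  prefix \<open>v\<close>: a best move is followed for each next letter, and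
  \<open>potential_gain\<close> gives the average. The term \<open>- 50\<close> pays for the final
  potential.\<close>

lemma sum_twin_total_ge_reach:
  assumes "reach v s r" "wf_state s"
  shows "10 ^ k * (50 * real r + real_of_int (potential s) - 50 + 433 / 10 * real k)
           \<le> (\<Sum>w\<in>words k. 50 * real (twin_total (v @ w)))"
  using assms
proof (induction k arbitrary: v s r)
  case 0
  have "real r \<le> real (twin_total v)" "real_of_int (potential s) \<le> 50"
    using reach_le_twin_total[OF "0"(1)] potential_le[OF "0"(2)] by simp_all
  then show ?case by (simp add: words_0)
next
  case (Suc k)
  define c where "c = 50 * real r - 50 + 433 / 10 * real k"
  have step: "10 ^ k * (c + real_of_int (best_of potential (moves s x)))
      \<le> (\<Sum>w\<in>words k. 50 * real (twin_total (v @ x # w)))" if "x < 10" for x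
  proof -
    obtain j s' where js: "(j, s') \<in> set (moves s x)"
      "best_of potential (moves s x) = 50 * int j + potential s'"
      using best_of_attained[OF moves_nonempty] .
    from Suc.IH[OF reach_moves[OF Suc.prems(1) js(1)] wf_moves[OF Suc.prems(2) that js(1)]]
    show ?thesis by (simp add: js(2) c_def algebra_simps)
  qed
  have "10 * real_of_int (potential s) + 433 = real_of_int (10 * potential s + 433)" by simp
  also have "\<dots> \<le> real_of_int (\<Sum>x<10. best_of potential (moves s x))"
    unfolding of_int_le_iff by (rule potential_gain[OF Suc.prems(2)])
  also have "\<dots> = (\<Sum>x<10. real_of_int (best_of potential (moves s x)))" by simp
  finally have gain: "10 * real_of_int (potential s) + 433 \<le> \<dots>" .
  have "10 ^ Suc k * (50 * real r + real_of_int (potential s) - 50 + 433 / 10 * real (Suc k))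
      = 10 ^ k * (10 * c + (10 * real_of_int (potential s) + 433))"
    by (simp add: c_def algebra_simps)
  also have "\<dots> \<le> 10 ^ k * (10 * c + (\<Sum>x<10. real_of_int (best_of potential (moves s x))))"
    using gain by (intro mult_left_mono) auto
  also have "\<dots> = (\<Sum>x<10. 10 ^ k * (c + real_of_int (best_of potential (moves s x))))"
    by (simp add: sum_distrib_left[symmetric] sum.distrib)
  also have "\<dots> \<le> (\<Sum>x<10. \<Sum>w\<in>words k. 50 * real (twin_total (v @ x # w)))"
    by (intro sum_mono step) auto
  finally show ?case by (simp only: sum_words_Suc)
qed

lemma sum_twin_total_ge:
  "10 ^ k * (433 / 500 * real k - 2) \<le> (\<Sum>w\<in>words k. real (twin_total w))"
proof -
  \<comment> \<open>Both subsequences start empty. The potential of \<open>Low 0 0\<close> is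
    \<open>- 16\<close>, so the total loss is 66 units, less than two letters.\<close>
  have "reach [] (Low 0 0) 0"
    using disjoint_subseqs.empty by (auto simp: attains_def awaits_rise_def)
  from sum_twin_total_ge_reach[OF this, of k]
  have "10 ^ k * (433 / 10 * real k - 66) \<le> 50 * (\<Sum>w\<in>words k. real (twin_total w))"
    by (simp add: low_table_def sum_distrib_left)
  then have le: "10 ^ k * (433 / 10 * real k - 66) / 50 \<le> (\<Sum>w\<in>words k. real (twin_total w))"
    by simp
  have "10 ^ k * (433 / 500 * real k - 2) \<le> 10 ^ k * ((433 / 10 * real k - 66) / 50)"
    by (intro mult_left_mono) auto
  also have "\<dots> = 10 ^ k * (433 / 10 * real k - 66) / 50" by simp
  finally show ?thesis using le by linarith
qed

section \<open>Concatenation of blocks\<close>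

text \<open>By even length \<open>xs\<close> ends at a valley and \<open>ys\<close> begins at a
  peak. If the junction fails to rise, these two entries are deleted, which costs 2 and keeps the
  length even.\<close>

lemma alternating_join:
  fixes xs ys :: "nat list" and f :: "nat \<Rightarrow> nat"
  assumes xs: "alt True (map f xs)" "even (length xs)"
    and ys: "alt True (map f ys)" "even (length ys)"
    and sorted: "sorted_wrt (<) (xs @ ys)"
  obtains zs where "alt True (map f zs)" "even (length zs)" "sorted_wrt (<) zs"
    "set zs \<subseteq> set xs \<union> set ys" "length xs + length ys \<le> length zs + 2"
    "length zs \<le> length xs + length ys"
proof -
  have sorted': "sorted_wrt (<) xs" "sorted_wrt (<) ys"
    using sorted by (auto simp: sorted_wrt_append)
  consider "xs = []" | "ys = []" | "xs \<noteq> []" "ys \<noteq> []" "f (last xs) < f (hd ys)"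
    | "xs \<noteq> []" "ys \<noteq> []" "f (hd ys) \<le> f (last xs)" by linarith
  then show ?thesis
  proof cases
    case 1 then show ?thesis using ys sorted' by (intro that[of ys]) auto
  next
    case 2 then show ?thesis using xs sorted' by (intro that[of xs]) auto
  next
    case 3
    then show ?thesis using xs ys sorted
      by (intro that[of "xs @ ys"]) (auto simp: alt_append last_map hd_map)
  next
    case 4
    obtain c l where c: "xs = c @ [l]" using 4(1) by (cases xs rule: rev_cases) auto
    obtain h t where t: "ys = h # t" using 4(2) by (cases ys) auto
    obtain h' t' where t': "t = h' # t'" using ys(2) t by (cases t) auto
    have "c \<noteq> []" "odd (length c)" using xs(2) c by (cases c, auto)
    moreover from this have "alt True (map f c)" "f l < f (last c)"
      using xs(1) c by (auto simp: alt_snoc last_map)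
    \<comment> \<open>The chain \<open>f (last c) > f l \<ge> f h > f h'\<close> provides the
      descent that the odd length of \<open>c\<close> demands.\<close>
    ultimately have "alt True (map f (c @ t))"
      using ys(1) t t' 4(3) c by (auto simp: alt_append last_map)
    then show ?thesis
      using xs(2) ys(2) c t sorted by (intro that[of "c @ t"]) (auto simp: sorted_wrt_append)
  qed
qed

definition block :: "nat \<Rightarrow> nat \<Rightarrow> nat list" where
  "block K j = [Suc (j * K)..<Suc (j * K + K)]"

lemma length_block: "length (block K j) = K"
  by (simp add: block_def)

text \<open>An optimal pair for the levels is transferred to positions. Deleting a last entry where
  needed makes both lengths even, at a total cost of at most 2.\<close>

lemma block_twins:
  fixes g :: "nat \<Rightarrow> nat" and \<pi> :: "nat \<Rightarrow> nat"
  assumes "mono g"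
  obtains A C where "alt True (map \<pi> A)" "even (length A)" "alt True (map \<pi> C)" "even (length C)"
    "sorted_wrt (<) A" "sorted_wrt (<) C" "set A \<inter> set C = {}" "set A \<union> set C \<subseteq> {j * K<..j * K + K}"
    "length A \<le> length C" "length C \<le> K"
    "twin_total (map (\<lambda>i. g (\<pi> i)) (block K j)) \<le> length A + length C + 2"
proof -
  let ?w = "map (\<lambda>i. g (\<pi> i)) (block K j)"
  obtain p q where pq: "disjoint_subseqs ?w p q" "alt True p" "alt True q"
    "twin_total ?w = length p + length q"
    using twin_total_attained .
  obtain A C where AC: "disjoint_subseqs (block K j) A C"
    "p = map (\<lambda>i. g (\<pi> i)) A" "q = map (\<lambda>i. g (\<pi> i)) C"
    using disjoint_subseqs_map[OF pq(1)] .
  have alt: "alt True (map \<pi> A)" "alt True (map \<pi> C)"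
    using pq(2,3) alt_map_reflect[OF assms, of True "map \<pi> A"]
      alt_map_reflect[OF assms, of True "map \<pi> C"] by (simp_all add: AC comp_def)
  define trim where "trim X = take (2 * (length X div 2)) X" for X :: "nat list"
  have len: "length (trim X) = 2 * (length X div 2)" for X by (simp add: trim_def)
  then have trim: "even (length (trim X))" "length X \<le> length (trim X) + 1"
    "length (trim X) \<le> length X" for X
    by simp_all
  have sub: "set (trim X) \<subseteq> set X" for X
    by (simp add: trim_def set_take_subset)
  have sorted_trim: "sorted_wrt (<) X \<Longrightarrow> sorted_wrt (<) (trim X)"
    and alt_trim: "alt True (map \<pi> X) \<Longrightarrow> alt True (map \<pi> (trim X))" for X
    by (simp_all add: trim_def sorted_wrt_take alt_take flip: take_map)
  have "sorted_wrt (<) (block K j)" by (simp add: block_def del: upt_Suc)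
  then have sorted: "sorted_wrt (<) A" "sorted_wrt (<) C" "set A \<inter> set C = {}"
    using disjoint_subseqs_sorted[OF AC(1)] by auto
  have range: "set (trim A) \<union> set (trim C) \<subseteq> {j * K<..j * K + K}"
    using disjoint_subseqs_set[OF AC(1)] sub[of A] sub[of C] by (auto simp: block_def)
  have disj: "set (trim A) \<inter> set (trim C) = {}"
    using sorted(3) sub[of A] sub[of C] by blast
  have "length A + length C \<le> K"
    using disjoint_subseqs_length[OF AC(1)] by (simp add: length_block)
  then have le: "length (trim A) \<le> K" "length (trim C) \<le> K"
    using trim(3)[of A] trim(3)[of C] by linarith+
  have total: "twin_total ?w \<le> length (trim A) + length (trim C) + 2"
    using pq(4) AC trim(2)[of A] trim(2)[of C] by simp
  note facts = alt_trim[OF alt(1)] alt_trim[OF alt(2)] trim(1)[of A] trim(1)[of C]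
    sorted_trim[OF sorted(1)] sorted_trim[OF sorted(2)]
  show ?thesis
  proof (cases "length (trim A) \<le> length (trim C)")
    case True
    then show ?thesis
      using that[of "trim A" "trim C"] facts range disj le total by blast
  next
    case False
    then have "length (trim C) \<le> length (trim A)" by simp
    moreover have "set (trim C) \<inter> set (trim A) = {}"
      "set (trim C) \<union> set (trim A) \<subseteq> {j * K<..j * K + K}"
      "twin_total ?w \<le> length (trim C) + length (trim A) + 2"
      using disj range total by (simp_all add: Int_commute Un_commute add.commute)
    ultimately show ?thesis
      using that[of "trim C" "trim A"] facts le by blast
  qed
qed

text \<open>A block costs at most 6: 2 for making lengths even and 2 for each of two joins. The
  longer piece goes to the shorter list \<open>Y\<close>, so the difference grows by at most 2 per
  block beyond \<open>K\<close>; the names are exchanged when the order flips.\<close>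

lemma sum_twin_total_le_twins:
  fixes g :: "nat \<Rightarrow> nat" and \<pi> :: "nat \<Rightarrow> nat"
  assumes "mono g"
  shows "\<exists>X Y. alt True (map \<pi> X) \<and> alt True (map \<pi> Y) \<and> even (length X) \<and> even (length Y) \<and>
    sorted_wrt (<) X \<and> sorted_wrt (<) Y \<and> set X \<inter> set Y = {} \<and> set X \<union> set Y \<subseteq> {1..B * K} \<and>
    (\<Sum>j<B. twin_total (map (\<lambda>i. g (\<pi> i)) (block K j))) \<le> length X + length Y + 6 * B \<and>
    length Y \<le> length X \<and> length X \<le> length Y + K + 2 * B"
proof (induction B)
  case 0
  show ?case by (intro exI[of _ "[]"]) auto
next
  case (Suc B)
  then obtain X Y where XY: "alt True (map \<pi> X)" "alt True (map \<pi> Y)" "even (length X)" "even (length Y)"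
    "sorted_wrt (<) X" "sorted_wrt (<) Y" "set X \<inter> set Y = {}" "set X \<union> set Y \<subseteq> {1..B * K}"
    "(\<Sum>j<B. twin_total (map (\<lambda>i. g (\<pi> i)) (block K j))) \<le> length X + length Y + 6 * B"
    "length Y \<le> length X" "length X \<le> length Y + K + 2 * B" by blast
  obtain A C where AC: "alt True (map \<pi> A)" "even (length A)" "alt True (map \<pi> C)" "even (length C)"
    "sorted_wrt (<) A" "sorted_wrt (<) C" "set A \<inter> set C = {}" "set A \<union> set C \<subseteq> {B * K<..B * K + K}"
    "length A \<le> length C" "length C \<le> K"
    "twin_total (map (\<lambda>i. g (\<pi> i)) (block K B)) \<le> length A + length C + 2"
    using block_twins[OF assms, of \<pi> B K] .
  have "sorted_wrt (<) (X @ A)" "sorted_wrt (<) (Y @ C)"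
    using XY(5,6,8) AC(5,6,8) by (fastforce simp: sorted_wrt_append)+
  then obtain X' Y' where
    X': "alt True (map \<pi> X')" "even (length X')" "sorted_wrt (<) X'" "set X' \<subseteq> set X \<union> set A"
      "length X + length A \<le> length X' + 2" "length X' \<le> length X + length A" and
    Y': "alt True (map \<pi> Y')" "even (length Y')" "sorted_wrt (<) Y'" "set Y' \<subseteq> set Y \<union> set C"
      "length Y + length C \<le> length Y' + 2" "length Y' \<le> length Y + length C"
    using alternating_join[OF XY(1,3) AC(1,2)] alternating_join[OF XY(2,4) AC(3,4)] by metis
  have "set X \<inter> set C = {}" "set A \<inter> set Y = {}"
    using XY(8) AC(8) by fastforce+
  then have disj: "set X' \<inter> set Y' = {}"
    using X'(4) Y'(4) XY(7) AC(7) by blast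
  have sub: "set X' \<union> set Y' \<subseteq> {1..Suc B * K}"
    using X'(4) Y'(4) XY(8) AC(8) by fastforce
  have total: "(\<Sum>j<Suc B. twin_total (map (\<lambda>i. g (\<pi> i)) (block K j)))
      \<le> length X' + length Y' + 6 * Suc B"
    using XY(9) AC(11) X'(5) Y'(5) by simp
  have le: "length X' \<le> length Y' + K + 2 * Suc B"
    using XY(11) AC(9) X'(6) Y'(5) unfolding mult_Suc_right by linarith
  have ge: "length Y' \<le> length X' + K + 2 * Suc B"
    using XY(10) AC(10) X'(5) Y'(6) unfolding mult_Suc_right by linarith
  show ?case
  proof (cases "length Y' \<le> length X'")
    case True
    then show ?thesis
      using X'(1-3) Y'(1-3) disj sub total le by (intro exI[of _ X'] exI[of _ Y'] conjI)
  next
    case False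
    moreover have "set Y' \<inter> set X' = {}" "set Y' \<union> set X' \<subseteq> {1..Suc B * K}"
      "(\<Sum>j<Suc B. twin_total (map (\<lambda>i. g (\<pi> i)) (block K j)))
        \<le> length Y' + length X' + 6 * Suc B"
      using disj sub total by (simp_all only: Int_commute Un_commute add.commute)
    ultimately show ?thesis
      using X'(1-3) Y'(1-3) ge by (intro exI[of _ Y'] exI[of _ X'] conjI) simp_all
  qed
qed

text \<open>Cutting the longer list to the length of the shorter one costs at most
  \<open>K + 2 * B\<close>, on top of the \<open>6 * B\<close> already lost.\<close>

lemma sum_twin_total_le:
  fixes g :: "nat \<Rightarrow> nat" and \<pi> :: "nat \<Rightarrow> nat"
  assumes "mono g" "B * K \<le> n"
  shows "(\<Sum>j<B. twin_total (map (\<lambda>i. g (\<pi> i)) (block K j)))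
    \<le> 2 * max_alternating_twins n \<pi> + 8 * B + K"
proof -
  obtain X Y where XY: "alt True (map \<pi> X)" "alt True (map \<pi> Y)"
    "sorted_wrt (<) X" "sorted_wrt (<) Y" "set X \<inter> set Y = {}" "set X \<union> set Y \<subseteq> {1..B * K}"
    "(\<Sum>j<B. twin_total (map (\<lambda>i. g (\<pi> i)) (block K j))) \<le> length X + length Y + 6 * B"
    "length Y \<le> length X" "length X \<le> length Y + K + 2 * B"
    using sum_twin_total_le_twins[OF assms(1), of \<pi> B K] by blast
  let ?X = "take (length Y) X"
  have "set ?X \<subseteq> set X" by (rule set_take_subset)
  then have "alternating_subseq n \<pi> ?X" "alternating_subseq n \<pi> Y" "set ?X \<inter> set Y = {}"
    using XY(1-6) assms(2)
    by (auto simp: alternating_subseq_iff_alt sorted_wrt_take take_map[symmetric] alt_take)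
  then have "has_alternating_twins n \<pi> (length Y)"
    using XY(8) unfolding has_alternating_twins_def by (intro exI[of _ ?X] exI[of _ Y]) auto
  then have "length Y \<le> max_alternating_twins n \<pi>"
    unfolding max_alternating_twins_def by (intro Max_ge finite_has_alternating_twins) auto
  then show ?thesis using XY(7,9) by linarith
qed

section \<open>Levels of a random permutation\<close>

text \<open>Composing with the transposition of \<open>v\<close> and \<open>p\<close> turns the
  permutations of \<open>S\<close> that send \<open>p\<close> to \<open>v\<close> into those of
  \<open>S - {p}\<close>, with the other prescribed values transposed as well.\<close>

lemma card_permutes_map_eq:
  assumes "finite S" "distinct ps" "distinct vs" "set ps \<subseteq> S" "set vs \<subseteq> S" "length ps = length vs"
  shows "card {\<pi>. \<pi> permutes S \<and> map \<pi> ps = vs} = fact (card S - length ps)"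
  using assms
proof (induction ps arbitrary: S vs)
  case Nil
  then show ?case by (simp add: card_permutations)
next
  case (Cons p ps)
  then obtain v vs' where vs: "vs = v # vs'" by (cases vs) auto
  let ?t = "Transposition.transpose v p"
  have pv: "p \<in> S" "v \<in> S" using Cons.prems vs by auto
  let ?P = "{\<pi>. \<pi> permutes S \<and> map \<pi> (p # ps) = vs}"
  let ?Q = "{\<pi>. \<pi> permutes (S - {p}) \<and> map \<pi> ps = map ?t vs'}"
  have tt: "?t \<circ> (?t \<circ> \<pi>) = \<pi>" for \<pi> :: "'a \<Rightarrow> 'a"
    by (simp add: fun_eq_iff)
  have "bij_betw (\<lambda>\<pi>. ?t \<circ> \<pi>) ?P ?Q"
  proof (rule bij_betw_byWitness[where f' = "\<lambda>\<pi>. ?t \<circ> \<pi>"])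
    show "(\<lambda>\<pi>. ?t \<circ> \<pi>) ` ?P \<subseteq> ?Q"
    proof (rule image_subsetI)
      fix \<pi> assume \<pi>: "\<pi> \<in> ?P"
      then have "?t \<circ> \<pi> permutes S"
        using permutes_compose[OF _ permutes_swap_id[OF pv(2,1)]] by auto
      then have "?t \<circ> \<pi> permutes (S - {p})"
        by (rule permutes_superset) (use \<pi> vs in auto)
      then show "?t \<circ> \<pi> \<in> ?Q" using \<pi> vs by auto
    qed
    show "(\<lambda>\<pi>. ?t \<circ> \<pi>) ` ?Q \<subseteq> ?P"
    proof (rule image_subsetI)
      fix \<pi> assume \<pi>: "\<pi> \<in> ?Q"
      then have "\<pi> permutes S" by (auto intro: permutes_subset)
      then have "?t \<circ> \<pi> permutes S"
        using permutes_compose[OF _ permutes_swap_id[OF pv(2,1)]] by auto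
      moreover have "\<pi> p = p" using \<pi> by (auto intro: permutes_not_in)
      moreover have "map ?t (map ?t vs') = vs'" by (simp add: map_idI)
      then have "map (?t \<circ> \<pi>) ps = vs'"
        using \<pi> by (simp flip: map_map)
      ultimately show "?t \<circ> \<pi> \<in> ?P" using vs by simp
    qed
  qed (simp_all add: tt)
  then have "card ?P = card ?Q" by (rule bij_betw_same_card)
  also have "\<dots> = fact (card (S - {p}) - length ps)"
  proof (rule Cons.IH)
    have "?t x \<in> S - {p}" if "x \<in> set vs'" for x
      using that Cons.prems vs pv by (auto simp: Transposition.transpose_def)
    then show "set (map ?t vs') \<subseteq> S - {p}" by auto
    show "distinct (map ?t vs')"
      using Cons.prems vs by (simp add: distinct_map)
  qed (use Cons.prems vs in auto)
  finally show ?case using Cons.prems pv by simp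
qed

definition falling :: "nat \<Rightarrow> nat \<Rightarrow> real" where
  "falling n L = (\<Prod>i<L. real n - real i)"

lemma fact_eq_falling: "L \<le> n \<Longrightarrow> fact n = falling n L * fact (n - L)"
proof (induction L)
  case (Suc L)
  then have "fact n = falling n L * fact (Suc (n - Suc L))" by (simp add: Suc_diff_Suc)
  also have "\<dots> = falling n L * ((real n - real L) * fact (n - Suc L))"
    using Suc.prems by (subst fact_Suc) (simp add: of_nat_diff)
  finally show ?case by (simp add: falling_def)
qed (simp add: falling_def)

lemma falling_tendsto: "(\<lambda>n. falling n L / real n ^ L) \<longlonglongrightarrow> 1"
proof -
  have "(\<lambda>n. \<Prod>i<L. (real n - real i) / real n) \<longlonglongrightarrow> (\<Prod>i<L. 1)"
    by (intro tendsto_prod) real_asymp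
  then show ?thesis by (simp add: falling_def prod_dividef)
qed

text \<open>Only value lists without repetition occur, each for exactly \<open>fact (n - L)\<close>
  permutations.\<close>

lemma prob_random_permutation_map:
  assumes ps: "distinct ps" "set ps \<subseteq> {1..n}" "length ps = L"
    and V: "\<And>vs. vs \<in> V \<Longrightarrow> set vs \<subseteq> {1..n} \<and> length vs = L"
  shows "measure_pmf.prob (random_permutation n) {\<pi>. map \<pi> ps \<in> V}
    = real (card {vs \<in> V. distinct vs}) / falling n L"
proof -
  let ?Perm = "{\<pi>. \<pi> permutes {1..n}}"
  have "L \<le> n" using card_mono[OF _ ps(2)] distinct_card[OF ps(1)] ps(3) by simp
  have fin: "finite ?Perm" by (simp add: finite_permutations)
  have "finite V"
    by (rule finite_subset[OF _ finite_lists_length_eq[of "{1..n}" L]]) (use V in auto)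
  have "?Perm \<inter> {\<pi>. map \<pi> ps \<in> V} = (\<Union>vs\<in>{vs\<in>V. distinct vs}. {\<pi>. \<pi> permutes {1..n} \<and> map \<pi> ps = vs})"
    using ps(1) by (auto simp: distinct_map intro: permutes_inj_on)
  also have "card \<dots> = (\<Sum>vs\<in>{vs\<in>V. distinct vs}. card {\<pi>. \<pi> permutes {1..n} \<and> map \<pi> ps = vs})"
    using \<open>finite V\<close> by (intro card_UN_disjoint) (auto intro: finite_subset[OF _ fin])
  also have "\<dots> = (\<Sum>vs\<in>{vs\<in>V. distinct vs}. fact (n - L))"
    by (intro sum.cong refl) (use ps V card_permutes_map_eq[of "{1..n}" ps] in auto)
  finally have "card (?Perm \<inter> {\<pi>. map \<pi> ps \<in> V}) = card {vs\<in>V. distinct vs} * fact (n - L)"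
    by simp
  moreover have "?Perm \<noteq> {}" using permutes_id by blast
  moreover have "card ?Perm = fact n" by (simp add: card_permutations)
  ultimately show ?thesis
    using fin fact_eq_falling[OF \<open>L \<le> n\<close>]
    by (simp add: random_permutation_def measure_pmf_of_set)
qed

text \<open>Apply \<open>prob_random_permutation_map\<close> to the certain event that all values
  lie in \<open>{1..n}\<close>.\<close>

lemma card_distinct_lists_falling:
  assumes "L \<le> n"
  shows "real (card {vs. set vs \<subseteq> {1..n} \<and> length vs = L \<and> distinct vs}) = falling n L"
proof -
  let ?V = "{vs. set vs \<subseteq> {1..n} \<and> length vs = L}"
  have "falling n L \<noteq> 0" using fact_eq_falling[OF assms] by (metis fact_nonzero mult_zero_left)
  have "measure_pmf.prob (random_permutation n) {\<pi>. map \<pi> [1..<Suc L] \<in> ?V} = 1"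
  proof (rule measure_pmf.prob_eq_1[THEN iffD2])
    have "set_pmf (random_permutation n) = {\<pi>. \<pi> permutes {1..n}}"
      unfolding random_permutation_def
      by (rule set_pmf_of_set) (auto simp: finite_permutations intro: permutes_id)
    moreover have "map \<pi> [1..<Suc L] \<in> ?V" if "\<pi> permutes {1..n}" for \<pi>
    proof -
      have "\<pi> ` {1..<Suc L} \<subseteq> \<pi> ` {1..n}" using assms by (intro image_mono) auto
      then have "\<pi> ` {1..<Suc L} \<subseteq> {1..n}" unfolding permutes_image[OF that] .
      then show ?thesis by (simp del: upt_Suc)
    qed
    ultimately show "AE \<pi> in random_permutation n. \<pi> \<in> {\<pi>. map \<pi> [1..<Suc L] \<in> ?V}"
      by (simp add: AE_measure_pmf_iff)
  qed simp
  moreover have "measure_pmf.prob (random_permutation n) {\<pi>. map \<pi> [1..<Suc L] \<in> ?V}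
      = real (card {vs \<in> ?V. distinct vs}) / falling n L"
    by (rule prob_random_permutation_map) (use assms in \<open>auto simp del: upt_Suc\<close>)
  moreover have "{vs \<in> ?V. distinct vs} = {vs. set vs \<subseteq> {1..n} \<and> length vs = L \<and> distinct vs}"
    by blast
  ultimately show ?thesis using \<open>falling n L \<noteq> 0\<close> by (metis divide_eq_1_iff)
qed

section \<open>Joint distribution of the levels\<close>

definition level :: "nat \<Rightarrow> nat \<Rightarrow> nat" where
  "level q v = min 9 ((v - 1) div q)"

lemma mono_level: "mono (level q)"
  unfolding level_def by (intro monoI min.mono div_le_mono diff_le_mono) auto

lemma level_less: "level q v < 10"
  by (simp add: level_def)

text \<open>Levels below 9 consist of exactly \<open>q\<close> values. Level 9 also receives the at
  most nine values beyond \<open>10 * q\<close>.\<close>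

lemma card_level:
  assumes "10 * q \<le> n" "n < 10 * q + 10" "0 < q" "i < 10"
  shows "q \<le> card {v \<in> {1..n}. level q v = i}" "card {v \<in> {1..n}. level q v = i} \<le> q + 10"
proof -
  have "q \<le> card {v \<in> {1..n}. level q v = i} \<and> card {v \<in> {1..n}. level q v = i} \<le> q + 10"
  proof (cases "i = 9")
    case True
    have "level q v = i \<longleftrightarrow> 9 \<le> (v - 1) div q" for v
      using True by (simp add: level_def min_def)
    also have "\<dots> v \<longleftrightarrow> 9 * q \<le> v - 1" for v
      using assms(3) by (rule less_eq_div_iff_mult_less_eq)
    finally have "{v \<in> {1..n}. level q v = i} = {v \<in> {1..n}. 9 * q \<le> v - 1}" by simp
    also have "\<dots> = {9 * q + 1..n}" by auto
    finally have "card {v \<in> {1..n}. level q v = i} = n - 9 * q" by simp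
    then show ?thesis using assms(1,2) by arith
  next
    case False
    then have i: "i < 9" using assms(4) by simp
    have "min 9 a = i \<longleftrightarrow> i \<le> a \<and> a < Suc i" for a
      using i by (auto simp: min_def)
    then have "level q v = i \<longleftrightarrow> i \<le> (v - 1) div q \<and> (v - 1) div q < Suc i" for v
      unfolding level_def .
    then have "level q v = i \<longleftrightarrow> i * q \<le> v - 1 \<and> v - 1 < Suc i * q" for v
      unfolding less_eq_div_iff_mult_less_eq[OF assms(3)] div_less_iff_less_mult[OF assms(3)] .
    then have "{v \<in> {1..n}. level q v = i} = {v \<in> {1..n}. i * q \<le> v - 1 \<and> v - 1 < Suc i * q}"
      by simp
    also have "\<dots> = {i * q + 1..i * q + q}"
    proof -
      have "Suc i * q \<le> 10 * q" using assms(4) by (intro mult_le_mono1) simp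
      then have "i * q + q \<le> n" using assms(1) unfolding mult_Suc by linarith
      then show ?thesis unfolding mult_Suc by (intro set_eqI) (simp, arith)
    qed
    finally show ?thesis by simp
  qed
  then show "q \<le> card {v \<in> {1..n}. level q v = i}" "card {v \<in> {1..n}. level q v = i} \<le> q + 10"
    by auto
qed

lemma card_level_lists:
  assumes "10 * q \<le> n" "n < 10 * q + 10" "0 < q" "w \<in> words L"
  shows "q ^ L \<le> card {vs. set vs \<subseteq> {1..n} \<and> map (level q) vs = w}"
    "card {vs. set vs \<subseteq> {1..n} \<and> map (level q) vs = w} \<le> (q + 10) ^ L"
proof -
  have "q ^ L \<le> card {vs. set vs \<subseteq> {1..n} \<and> map (level q) vs = w} \<and>
    card {vs. set vs \<subseteq> {1..n} \<and> map (level q) vs = w} \<le> (q + 10) ^ L"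
    using assms(4)
  proof (induction L arbitrary: w)
    case 0
    then have "{vs. set vs \<subseteq> {1..n} \<and> map (level q) vs = w} = {[]}" by (auto simp: words_def)
    then show ?case by simp
  next
    case (Suc L)
    then obtain x w' where w: "w = x # w'" "x < 10" "w' \<in> words L"
      by (auto simp: words_def length_Suc_conv)
    let ?A = "{v \<in> {1..n}. level q v = x}"
    let ?B = "{vs. set vs \<subseteq> {1..n} \<and> map (level q) vs = w'}"
    have "{vs. set vs \<subseteq> {1..n} \<and> map (level q) vs = w} = (\<lambda>(v, vs). v # vs) ` (?A \<times> ?B)"
      by (auto simp: w image_iff Cons_eq_map_conv map_eq_Cons_conv)
    then have "card {vs. set vs \<subseteq> {1..n} \<and> map (level q) vs = w} = card ?A * card ?B"
      by (simp add: card_image inj_on_def card_cartesian_product)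
    then show ?case
      using Suc.IH[OF w(3)] card_level[OF assms(1-3) w(2)] by (simp only: power_Suc mult_le_mono)
  qed
  then show "q ^ L \<le> card {vs. set vs \<subseteq> {1..n} \<and> map (level q) vs = w}"
    "card {vs. set vs \<subseteq> {1..n} \<and> map (level q) vs = w} \<le> (q + 10) ^ L" by auto
qed

lemma set_pmf_random_permutation: "set_pmf (random_permutation n) = {\<pi>. \<pi> permutes {1..n}}"
  unfolding random_permutation_def
  by (rule set_pmf_of_set) (auto simp: finite_permutations intro: permutes_id)

text \<open>With \<open>V\<close> the value lists of the right levels and \<open>D\<close> those
  without repetition, the upper bound counts all of \<open>V\<close>, and the lower one uses that
  \<open>V \<inter> D\<close> has at least \<open>card V + card D - card A\<close> elements.\<close>

lemma prob_levels_bounds: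
  assumes "L \<le> n" "10 \<le> n" and ps: "distinct ps" "set ps \<subseteq> {1..n}" "length ps = L"
    and w: "w \<in> words L"
  defines "p \<equiv> measure_pmf.prob (random_permutation n) {\<pi>. map (\<lambda>i. level (n div 10) (\<pi> i)) ps = w}"
  shows "(real (n div 10) ^ L - real n ^ L + falling n L) / falling n L \<le> p"
    "p \<le> real (n div 10 + 10) ^ L / falling n L"
proof -
  let ?q = "n div 10"
  define A where "A = {vs. set vs \<subseteq> {1..n} \<and> length vs = L}"
  define D where "D = {vs. set vs \<subseteq> {1..n} \<and> length vs = L \<and> distinct vs}"
  define V where "V = {vs. set vs \<subseteq> {1..n} \<and> map (level ?q) vs = w}"
  have q: "10 * ?q \<le> n" "n < 10 * ?q + 10" "0 < ?q"
    using assms(2) by (auto simp: div_greater_zero_iff)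
  have "length w = L" using w by (simp add: words_def)
  then have VA: "V \<subseteq> A" unfolding V_def A_def by auto
  have DA: "D \<subseteq> A" unfolding D_def A_def by auto
  have finA: "finite A" unfolding A_def by (rule finite_lists_length_eq) simp
  note finV = finite_subset[OF VA finA] and finD = finite_subset[OF DA finA]
  have pos: "falling n L > 0"
    unfolding falling_def using assms(1) by (intro prod_pos) auto
  have "p = measure_pmf.prob (random_permutation n) {\<pi>. map \<pi> ps \<in> V}"
    unfolding p_def
  proof (rule measure_pmf.finite_measure_eq_AE)
    have "set (map \<pi> ps) \<subseteq> {1..n}" if "\<pi> permutes {1..n}" for \<pi>
      using image_mono[OF ps(2), of \<pi>] unfolding permutes_image[OF that] by simp
    then show "AE \<pi> in random_permutation n.
        (\<pi> \<in> {\<pi>. map (\<lambda>i. level ?q (\<pi> i)) ps = w}) = (\<pi> \<in> {\<pi>. map \<pi> ps \<in> V})"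
      by (simp add: AE_measure_pmf_iff set_pmf_random_permutation V_def comp_def)
  qed auto
  also have "\<dots> = real (card {vs \<in> V. distinct vs}) / falling n L"
    by (rule prob_random_permutation_map[OF ps]) (use VA in \<open>unfold A_def, blast\<close>)
  also have "{vs \<in> V. distinct vs} = V \<inter> D"
    using VA unfolding A_def D_def by blast
  finally have p: "p = real (card (V \<inter> D)) / falling n L" .
  have "card (V \<inter> D) \<le> card V" by (intro card_mono finV) auto
  also have "\<dots> \<le> (?q + 10) ^ L" unfolding V_def by (rule card_level_lists[OF q w])
  finally have "real (card (V \<inter> D)) \<le> real ((?q + 10) ^ L)" by (rule of_nat_mono)
  then show "p \<le> real (?q + 10) ^ L / falling n L"
    unfolding p of_nat_power using pos by (intro divide_right_mono) auto
  have "card V + card D = card (V \<union> D) + card (V \<inter> D)"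
    by (rule card_Un_Int[OF finV finD])
  also have "card (V \<union> D) \<le> card A" using VA DA by (intro card_mono finA) auto
  finally have "real (card V) + real (card D) \<le> real (card A) + real (card (V \<inter> D))"
    unfolding of_nat_add[symmetric] by (intro of_nat_mono) simp
  moreover have "real (card A) = real n ^ L" using card_lists_length_eq[of "{1..n}" L] by (simp add: A_def)
  moreover have "real (card D) = falling n L"
    unfolding D_def by (rule card_distinct_lists_falling[OF assms(1)])
  moreover have "real ?q ^ L \<le> real (card V)"
    unfolding of_nat_power[symmetric] V_def by (rule of_nat_mono[OF card_level_lists(1)[OF q w]])
  ultimately have "real ?q ^ L - real n ^ L + falling n L \<le> real (card (V \<inter> D))" by linarith
  then show "(real ?q ^ L - real n ^ L + falling n L) / falling n L \<le> p"
    unfolding p using pos by (intro divide_right_mono) auto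
qed

text \<open>Both bounds tend to \<open>(1 / 10) ^ L\<close> and depend on neither \<open>ps\<close>
  nor \<open>w\<close>. This uniformity matters because the number of pairs of blocks grows with
  \<open>n\<close>.\<close>

lemma prob_levels:
  assumes "\<epsilon> > 0"
  shows "\<forall>\<^sub>F n in sequentially. \<forall>ps w. distinct ps \<longrightarrow> set ps \<subseteq> {1..n} \<longrightarrow> length ps = L \<longrightarrow> w \<in> words L \<longrightarrow>
    \<bar>measure_pmf.prob (random_permutation n) {\<pi>. map (\<lambda>i. level (n div 10) (\<pi> i)) ps = w}
       - (1 / 10) ^ L\<bar> \<le> \<epsilon>"
proof -
  define c where "c n = falling n L / real n ^ L" for n
  define lower where "lower n = ((real (n div 10) / real n) ^ L - 1 + c n) / c n" for n
  define upper where "upper n = (real (n div 10 + 10) / real n) ^ L / c n" for n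
  have c: "c \<longlonglongrightarrow> 1" unfolding c_def by (rule falling_tendsto)
  have q: "(\<lambda>n. real (n div 10) / real n) \<longlonglongrightarrow> 1 / 10"
  proof (rule tendsto_sandwich[of "\<lambda>n. (real n / 10 - 1) / real n" _ _ "\<lambda>n. (real n / 10) / real n"])
    have "real n / 10 - 1 \<le> real (n div 10)" for n by linarith
    then show "\<forall>\<^sub>F n in sequentially. (real n / 10 - 1) / real n \<le> real (n div 10) / real n"
      by (intro always_eventually allI divide_right_mono) auto
    have "real (n div 10) \<le> real n / 10" for n by linarith
    then show "\<forall>\<^sub>F n in sequentially. real (n div 10) / real n \<le> (real n / 10) / real n"
      by (intro always_eventually allI divide_right_mono) auto
  qed real_asymp+
  then have "(\<lambda>n. real (n div 10) / real n + 10 / real n) \<longlonglongrightarrow> 1 / 10 + 0"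
    by (rule tendsto_add) real_asymp
  then have q10: "(\<lambda>n. real (n div 10 + 10) / real n) \<longlonglongrightarrow> 1 / 10"
    by (simp add: add_divide_distrib)
  have "lower \<longlonglongrightarrow> ((1 / 10) ^ L - 1 + 1) / 1"
    unfolding lower_def
    by (rule tendsto_divide[OF tendsto_add[OF tendsto_diff[OF tendsto_power[OF q] tendsto_const] c] c]) simp
  moreover have "upper \<longlonglongrightarrow> (1 / 10) ^ L / 1"
    unfolding upper_def by (rule tendsto_divide[OF tendsto_power[OF q10] c]) simp
  ultimately have "\<forall>\<^sub>F n in sequentially. dist (lower n) ((1 / 10) ^ L) < \<epsilon>"
    "\<forall>\<^sub>F n in sequentially. dist (upper n) ((1 / 10) ^ L) < \<epsilon>"
    using assms by (auto dest: tendstoD)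
  then show ?thesis
    using eventually_ge_at_top[of "10 + L"]
  proof eventually_elim
    case (elim n)
    let ?q = "n div 10"
    have n: "L \<le> n" "10 \<le> n" using elim(3) by auto
    have pos: "falling n L > 0"
      unfolding falling_def using elim(3) by (intro prod_pos) auto
    have lower: "lower n = (real ?q ^ L - real n ^ L + falling n L) / falling n L"
      unfolding lower_def c_def using n pos by (simp add: field_simps power_divide)
    have upper: "upper n = real (?q + 10) ^ L / falling n L"
      unfolding upper_def c_def using n pos by (simp add: power_divide)
    show ?case
    proof (intro allI impI)
      fix ps w
      assume "distinct ps" "set ps \<subseteq> {1..n}" "length ps = L" "w \<in> words L"
      from prob_levels_bounds[OF n this]
      show "\<bar>measure_pmf.prob (random_permutation n) {\<pi>. map (\<lambda>i. level ?q (\<pi> i)) ps = w}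
          - (1 / 10) ^ L\<bar> \<le> \<epsilon>"
        using elim(1,2) unfolding lower upper dist_real_def by linarith
    qed
  qed
qed

section \<open>Concentration of the block totals\<close>

lemma finite_set_random_permutation: "finite (set_pmf (random_permutation n))"
  unfolding set_pmf_random_permutation by (simp add: finite_permutations)

lemma integrable_random_permutation:
  "integrable (random_permutation n) (f :: _ \<Rightarrow> real)"
  by (rule integrable_measure_pmf_finite[OF finite_set_random_permutation])

text \<open>Since \<open>G\<close> has mean zero under independent uniform letters, only the
  deviations of the word probabilities, at most \<open>e\<close> each, contribute.\<close>

lemma expectation_levels:
  fixes G :: "nat list \<Rightarrow> real"
  assumes prob: "\<And>w. w \<in> words L \<Longrightarrow>
      \<bar>measure_pmf.prob (random_permutation n) {\<pi>. map (\<lambda>i. level q (\<pi> i)) ps = w}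
       - (1 / 10) ^ L\<bar> \<le> e"
    and "length ps = L" "(\<Sum>w\<in>words L. G w) = 0"
  shows "\<bar>measure_pmf.expectation (random_permutation n) (\<lambda>\<pi>. G (map (\<lambda>i. level q (\<pi> i)) ps))\<bar>
    \<le> e * (\<Sum>w\<in>words L. \<bar>G w\<bar>)"
proof -
  let ?P = "\<lambda>w. measure_pmf.prob (random_permutation n) {\<pi>. map (\<lambda>i. level q (\<pi> i)) ps = w}"
  let ?f = "\<lambda>\<pi>. map (\<lambda>i. level q (\<pi> i)) ps"
  have "measure_pmf.expectation (random_permutation n) (\<lambda>\<pi>. G (?f \<pi>))
      = measure_pmf.expectation (map_pmf ?f (random_permutation n)) G" by simp
  also have "\<dots> = (\<Sum>w\<in>words L. G w * pmf (map_pmf ?f (random_permutation n)) w)"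
    by (rule integral_measure_pmf_real[OF finite_words])
      (auto simp: words_def level_less assms(2))
  also have "\<dots> = (\<Sum>w\<in>words L. G w * ?P w)"
    by (simp add: pmf_map vimage_def)
  also have "\<dots> = (\<Sum>w\<in>words L. G w * (?P w - (1 / 10) ^ L))"
    using assms(3) by (simp add: right_diff_distrib sum_subtractf flip: sum_distrib_right)
  also have "\<bar>\<dots>\<bar> \<le> (\<Sum>w\<in>words L. \<bar>G w * (?P w - (1 / 10) ^ L)\<bar>)" by (rule sum_abs)
  also have "\<dots> \<le> (\<Sum>w\<in>words L. e * \<bar>G w\<bar>)"
    unfolding abs_mult mult.commute[of e] using prob by (intro sum_mono mult_left_mono) auto
  finally show ?thesis by (simp add: sum_distrib_left)
qed

text \<open>The mean for independent uniform letters. Block totals are centered at it rather than at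
  their exact mean in the random permutation.\<close>

definition mean_twin_total :: "nat \<Rightarrow> real" where
  "mean_twin_total K = (\<Sum>w\<in>words K. real (twin_total w)) / 10 ^ K"

lemma mean_twin_total_bounds: "0 \<le> mean_twin_total K" "mean_twin_total K \<le> real K"
proof -
  show "0 \<le> mean_twin_total K" by (simp add: mean_twin_total_def sum_nonneg)
  have "(\<Sum>w\<in>words K. real (twin_total w)) \<le> (\<Sum>w\<in>words K. real K)"
    by (intro sum_mono) (use twin_total_le in \<open>fastforce simp: words_def\<close>)
  then show "mean_twin_total K \<le> real K"
    by (simp add: mean_twin_total_def card_words divide_le_eq mult.commute)
qed

text \<open>A word of length \<open>K + K\<close> is an arbitrary pair of words of length
  \<open>K\<close>, so the sum factors, and both factors vanish.\<close>

lemma sum_centered_pair: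
  "(\<Sum>w\<in>words (K + K). (real (twin_total (take K w)) - mean_twin_total K) *
     (real (twin_total (drop K w)) - mean_twin_total K)) = 0"
proof -
  let ?g = "\<lambda>w. real (twin_total w) - mean_twin_total K"
  have "(\<Sum>w\<in>words (K + K). ?g (take K w) * ?g (drop K w))
      = (\<Sum>(u, v)\<in>words K \<times> words K. ?g u * ?g v)"
    by (rule sum.reindex_bij_witness[of _ "\<lambda>(u, v). u @ v" "\<lambda>w. (take K w, drop K w)"])
      (auto simp: words_def dest: in_set_takeD in_set_dropD)
  also have "\<dots> = (\<Sum>u\<in>words K. ?g u) * (\<Sum>v\<in>words K. ?g v)"
    by (simp add: sum_product sum.cartesian_product)
  also have "(\<Sum>u\<in>words K. ?g u) = 0"
    by (simp add: sum_subtractf card_words mean_twin_total_def)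
  finally show ?thesis by simp
qed

abbreviation block_total :: "nat \<Rightarrow> nat \<Rightarrow> (nat \<Rightarrow> nat) \<Rightarrow> nat \<Rightarrow> nat" where
  "block_total n K \<pi> j \<equiv> twin_total (map (\<lambda>i. level (n div 10) (\<pi> i)) (block K j))"

text \<open>Expand the square: the diagonal terms are bounded by \<open>K ^ 2\<close>, and distinct
  blocks are almost uncorrelated by the asymptotic independence of levels.\<close>

lemma block_total_second_moment:
  assumes "\<delta> > 0"
  shows "\<forall>\<^sub>F n in sequentially. \<forall>B. B * K \<le> n \<longrightarrow>
    measure_pmf.expectation (random_permutation n)
      (\<lambda>\<pi>. (\<Sum>j<B. real (block_total n K \<pi> j) - mean_twin_total K)\<^sup>2)
      \<le> real B * real K ^ 2 + real B ^ 2 * \<delta>"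
proof -
  let ?\<mu> = "mean_twin_total K"
  define G where "G w = (real (twin_total (take K w)) - ?\<mu>) * (real (twin_total (drop K w)) - ?\<mu>)" for w :: "nat list"
  define C where "C = (\<Sum>w\<in>words (K + K). \<bar>G w\<bar>)"
  have "C \<ge> 0" by (simp add: C_def sum_nonneg)
  have G0: "(\<Sum>w\<in>words (K + K). G w) = 0" unfolding G_def by (rule sum_centered_pair)
  \<comment> \<open>This accuracy per word makes each mixed term at most \<open>\<delta>\<close>;
    adding 1 covers \<open>C = 0\<close>.\<close>
  have "\<delta> / (C + 1) > 0" using assms \<open>C \<ge> 0\<close> by simp
  from prob_levels[OF this, of "K + K"] show ?thesis
  proof eventually_elim
    case (elim n)
    let ?E = "measure_pmf.expectation (random_permutation n)"
    let ?X = "\<lambda>\<pi> j. real (block_total n K \<pi> j) - ?\<mu>"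
    show ?case
    proof (intro allI impI)
      fix B assume B: "B * K \<le> n"
      have diag: "?E (\<lambda>\<pi>. ?X \<pi> i * ?X \<pi> i) \<le> real K ^ 2" for i
      proof -
        have bound: "\<bar>?X \<pi> i\<bar> \<le> real K" for \<pi>
          using mean_twin_total_bounds[of K] twin_total_le[of "map (\<lambda>i. level (n div 10) (\<pi> i)) (block K i)"]
          by (auto simp: length_block abs_le_iff)
        then have "?X \<pi> i * ?X \<pi> i \<le> real K ^ 2" for \<pi>
          using power_mono[OF bound[of \<pi>] abs_ge_zero, of 2]
          unfolding power2_abs by (simp only: power2_eq_square)
        then have "?E (\<lambda>\<pi>. ?X \<pi> i * ?X \<pi> i) \<le> ?E (\<lambda>\<pi>. real K ^ 2)"
          by (intro integral_mono integrable_random_permutation) auto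
        then show ?thesis by simp
      qed
      have off: "?E (\<lambda>\<pi>. ?X \<pi> i * ?X \<pi> j) \<le> \<delta>" if "i < B" "j < B" "i \<noteq> j" for i j
      proof -
        let ?ps = "block K i @ block K j"
        have "Suc i * K \<le> B * K" "Suc j * K \<le> B * K"
          using that by (auto intro!: mult_le_mono1 simp del: mult_Suc)
        then have sub: "set ?ps \<subseteq> {1..n}" using B by (auto simp: block_def)
        have "Suc i * K \<le> j * K \<or> Suc j * K \<le> i * K"
          using that by (metis Suc_leI linorder_neqE_nat mult_le_mono1)
        then have dist: "distinct ?ps" by (auto simp: block_def)
        have len: "length ?ps = K + K" by (simp add: length_block)
        have "\<bar>?E (\<lambda>\<pi>. G (map (\<lambda>i. level (n div 10) (\<pi> i)) ?ps))\<bar> \<le> \<delta> / (C + 1) * C"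
          unfolding C_def using elim dist sub len
          by (intro expectation_levels[OF _ len G0]) (simp only: C_def)
        also have "\<dots> \<le> \<delta>" using assms \<open>C \<ge> 0\<close> by (simp add: divide_simps)
        also have "(\<lambda>\<pi>. G (map (\<lambda>i. level (n div 10) (\<pi> i)) ?ps)) = (\<lambda>\<pi>. ?X \<pi> i * ?X \<pi> j)"
          by (simp add: G_def length_block)
        finally show ?thesis by linarith
      qed
      have "?E (\<lambda>\<pi>. (\<Sum>j<B. ?X \<pi> j)\<^sup>2) = ?E (\<lambda>\<pi>. \<Sum>i<B. \<Sum>j<B. ?X \<pi> i * ?X \<pi> j)"
        by (simp add: power2_eq_square sum_product)
      also have "\<dots> = (\<Sum>i<B. \<Sum>j<B. ?E (\<lambda>\<pi>. ?X \<pi> i * ?X \<pi> j))"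
        by (simp add: Bochner_Integration.integral_sum integrable_random_permutation)
      also have "\<dots> \<le> (\<Sum>i<B. \<Sum>j<B. (if i = j then real K ^ 2 else 0) + \<delta>)"
        using diag off assms by (intro sum_mono) (auto intro: add_increasing2)
      also have "\<dots> = real B * real K ^ 2 + real B ^ 2 * \<delta>"
        by (simp add: sum.distrib power2_eq_square algebra_simps)
      finally show "?E (\<lambda>\<pi>. (\<Sum>j<B. ?X \<pi> j)\<^sup>2) \<le> real B * real K ^ 2 + real B ^ 2 * \<delta>" .
    qed
  qed
qed

text \<open>Chebyshev's argument for a shortfall of one letter per block, that is, of
  \<open>B\<close> in total.\<close>

lemma prob_few_block_totals:
  assumes "\<delta> > 0"
  shows "\<forall>\<^sub>F n in sequentially. \<forall>B. 0 < B \<longrightarrow> B * K \<le> n \<longrightarrow>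
    measure_pmf.prob (random_permutation n)
      {\<pi>. (\<Sum>j<B. real (block_total n K \<pi> j)) \<le> real B * (mean_twin_total K - 1)}
      \<le> real K ^ 2 / real B + \<delta>"
  using block_total_second_moment[OF assms, of K]
proof eventually_elim
  case (elim n)
  show ?case
  proof (intro allI impI)
    fix B assume B: "0 < B" "B * K \<le> n"
    let ?Y = "\<lambda>\<pi>. (\<Sum>j<B. real (block_total n K \<pi> j) - mean_twin_total K)\<^sup>2"
    let ?A = "{\<pi>. (\<Sum>j<B. real (block_total n K \<pi> j)) \<le> real B * (mean_twin_total K - 1)}"
    have "?A \<subseteq> {\<pi> \<in> space (random_permutation n). (real B)\<^sup>2 \<le> ?Y \<pi>}"
    proof
      fix \<pi> assume "\<pi> \<in> ?A"
      then have "real B \<le> - (\<Sum>j<B. real (block_total n K \<pi> j) - mean_twin_total K)"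
        by (simp add: sum_subtractf algebra_simps)
      then have "(real B)\<^sup>2 \<le> (- (\<Sum>j<B. real (block_total n K \<pi> j) - mean_twin_total K))\<^sup>2"
        by (rule power_mono) simp
      then show "\<pi> \<in> {\<pi> \<in> space (random_permutation n). (real B)\<^sup>2 \<le> ?Y \<pi>}" by simp
    qed
    then have "measure_pmf.prob (random_permutation n) ?A
        \<le> measure_pmf.prob (random_permutation n) {\<pi> \<in> space (random_permutation n). (real B)\<^sup>2 \<le> ?Y \<pi>}"
      by (intro measure_pmf.finite_measure_mono) auto
    also have "\<dots> \<le> measure_pmf.expectation (random_permutation n) ?Y / (real B)\<^sup>2"
      by (rule integral_Markov_inequality_measure[where A = UNIV])
        (use B in \<open>auto intro: integrable_random_permutation\<close>)
    also have "\<dots> \<le> (real B * real K ^ 2 + real B ^ 2 * \<delta>) / (real B)\<^sup>2"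
      using elim B by (intro divide_right_mono) auto
    also have "\<dots> = real K ^ 2 / real B + \<delta>"
      using B by (simp add: field_simps power2_eq_square)
    finally show "measure_pmf.prob (random_permutation n) ?A \<le> real K ^ 2 / real B + \<delta>" .
  qed
qed

section \<open>The linear lower bound\<close>

lemma mean_twin_total_ge: "433 / 500 * real K - 2 \<le> mean_twin_total K"
  using sum_twin_total_ge[of K] by (simp add: mean_twin_total_def pos_le_divide_eq mult.commute)

text \<open>
  For blocks of length \<open>10000\<close> the bounded loss per block is smaller than the slack
  \<open>433 / 500 - 2 (1 / 3 + 0.0989)\<close> per letter; the condition on \<open>n\<close> absorbs the last, incomplete block.
\<close>

lemma max_alternating_twins_ge:
  assumes "K = 10000" "5000 * K \<le> n"
    and "real (n div K) * (mean_twin_total K - 1) < (\<Sum>j<n div K. real (block_total n K \<pi> j))"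
  shows "(1 / 3 + 0.0989) * real n \<le> real (max_alternating_twins n \<pi>)"
proof -
  define B where "B = n div K"
  have "B * K \<le> n" by (simp add: B_def)
  have "n < B * K + K"
    using dividend_less_div_times[of K n] assms(1) unfolding B_def by (simp only: add.commute zero_less_numeral)
  then have BK: "real n \<le> real B * real K + real K" "real B * real K \<le> real n"
    using \<open>B * K \<le> n\<close>
    unfolding of_nat_add[symmetric] of_nat_mult[symmetric] of_nat_le_iff by simp_all
  have "real (\<Sum>j<B. block_total n K \<pi> j) \<le> real (2 * max_alternating_twins n \<pi> + 8 * B + K)"
    using sum_twin_total_le[OF mono_level \<open>B * K \<le> n\<close>] by (rule of_nat_mono)
  moreover have "real B * (433 / 500 * real K - 3) \<le> real B * (mean_twin_total K - 1)"
    using mean_twin_total_ge[of K] by (intro mult_left_mono) auto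
  ultimately have "real B * (433 / 500 * real K - 3)
      \<le> 2 * real (max_alternating_twins n \<pi>) + 8 * real B + real K"
    using assms(3) unfolding B_def[symmetric] by simp
  \<comment> \<open>Each block yields \<open>8660 - 3 - 8\<close> where less than 8645 is required.
    With at least 4999 blocks the surplus exceeds \<open>K\<close> plus the requirement of the
    incomplete block, less than 18645 together.\<close>
  then show ?thesis using BK assms(1,2) by simp
qed

theorem theorem7:
  fixes \<epsilon> :: real
  assumes "\<epsilon> > 0"
  shows "(\<lambda>n. measure_pmf.prob (random_permutation n)
            {\<pi>. real (max_alternating_twins n \<pi>) \<ge> (1 / 3 + 0.0989 - \<epsilon>) * real n})
         \<longlonglongrightarrow> 1"
proof (rule tendstoI)
  fix \<eta> :: real assume "\<eta> > 0"
  obtain K :: nat where K: "K = 10000" by simp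
  have "(\<lambda>n. real K ^ 2 / real (n div K)) \<longlonglongrightarrow> 0"
  proof -
    have "filterlim (\<lambda>n. n div K) at_top sequentially"
      using K by (intro filterlim_at_top_div_const_nat) simp
    then show ?thesis
      by (intro tendsto_divide_0[OF tendsto_const] filterlim_at_top_imp_at_infinity
          filterlim_compose[OF filterlim_real_sequentially])
  qed
  then have "\<forall>\<^sub>F n in sequentially. real K ^ 2 / real (n div K) < \<eta> / 2"
    using \<open>\<eta> > 0\<close> by (intro order_tendstoD(2)) auto
  \<comment> \<open>One half of \<open>\<eta>\<close> is for the diagonal term of the second moment,
    the other for the correlations.\<close>
  moreover have "\<eta> / 2 > 0" using \<open>\<eta> > 0\<close> by simp
  note prob_few_block_totals[OF this, of K]
  ultimately show "\<forall>\<^sub>F n in sequentially. dist (measure_pmf.prob (random_permutation n)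
            {\<pi>. real (max_alternating_twins n \<pi>) \<ge> (1 / 3 + 0.0989 - \<epsilon>) * real n}) 1 < \<eta>"
    using eventually_ge_at_top[of "5000 * K"]
  proof eventually_elim
    case (elim n)
    let ?Good = "{\<pi>. real (max_alternating_twins n \<pi>) \<ge> (1 / 3 + 0.0989 - \<epsilon>) * real n}"
    let ?Bad = "{\<pi>. (\<Sum>j<n div K. real (block_total n K \<pi> j))
      \<le> real (n div K) * (mean_twin_total K - 1)}"
    have "0 < n div K" using elim(3) K by (simp add: div_greater_zero_iff)
    have "measure_pmf.prob (random_permutation n) ?Bad < \<eta>"
      using elim(1) elim(2)[rule_format, OF \<open>0 < n div K\<close> div_times_less_eq_dividend] by linarith
    \<comment> \<open>Outside the bad event the bound holds even without subtracting
      \<open>\<epsilon>\<close>.\<close>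
    moreover have "- ?Bad \<subseteq> ?Good"
    proof
      fix \<pi> assume "\<pi> \<in> - ?Bad"
      then have "(1 / 3 + 0.0989) * real n \<le> real (max_alternating_twins n \<pi>)"
        using elim(3) by (intro max_alternating_twins_ge[OF K]) auto
      moreover have "(1 / 3 + 0.0989 - \<epsilon>) * real n \<le> (1 / 3 + 0.0989) * real n"
        using assms by (intro mult_right_mono) auto
      ultimately show "\<pi> \<in> ?Good" by simp
    qed
    then have "measure_pmf.prob (random_permutation n) (- ?Bad) \<le> measure_pmf.prob (random_permutation n) ?Good"
      by (intro measure_pmf.finite_measure_mono) auto
    moreover have "measure_pmf.prob (random_permutation n) (- ?Bad)
        = 1 - measure_pmf.prob (random_permutation n) ?Bad"
      using measure_pmf.prob_compl[of ?Bad "random_permutation n"] by (simp add: Compl_eq_Diff_UNIV)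
    moreover have "measure_pmf.prob (random_permutation n) ?Good \<le> 1" by simp
    ultimately show ?case by (simp add: dist_real_def)
  qed
qed

end
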